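(* For any integer $n\geq 1$ we have \[ |\mathsf{BP}_n| = \sum_{i=1}^{p(n)} \prod_{j=1}^{d(i)} \binom{n-\sum_{k=1}^{j-1} k\cdot m(i,k)}{j\cdot m(i,j)} \cdot \frac{(j\cdot m(i,j))!}{m(i,j)!}. \]
   Context: Notation: $\llbracket n\rrbracket=\{0,\dots,n-1\}$. A partitioned order of $\llbracket n\rrbracket$ is an (unordered) set $\{S_k\}_{k\in\llbracket s\rrbracket}$ of $s$ non-empty finite sequences, each consisting of pairwise distinct elements of $\llbracket n\rrbracket$, the sequences being pairwise disjoint (as sets of entries) with union $\llbracket n\rrbracket$; so every element of $\llbracket n\rrbracket$ occurs at exactly one position of exactly one sequence. $\mathsf{BP}_n$ is the set of all partitioned orders of $\llbracket n\rrbracket$ (called block-parallel update modes of size $n$). Integer partitions: $p(n)$ is the number of integer partitions of $n$ (multisets of positive integers summing to $n$), listed in some fixed order as partitions number $1,\dots,p(n)$; $d(i)$ is the maximal part size of the $i$-th partition, and $m(i,j)$ is the multiplicity of the part of size $j$ in the $i$-th partition (possibly $0$). The product over $j$ ranges over the whole expression (binomial coefficient times ratio of factorials). *)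

theory Defs
  imports Complex_Main "HOL-Library.Multiset" "HOL-Library.Disjoint_Sets"
begin

definition partitioned_order :: "nat \<Rightarrow> nat list set \<Rightarrow> bool" where
  "partitioned_order n P \<longleftrightarrow>
     finite P \<and> (\<forall>S\<in>P. S \<noteq> [] \<and> distinct S) \<and>
     disjoint_family_on set P \<and> (\<Union>S\<in>P. set S) = {0..<n}"

definition BP :: "nat \<Rightarrow> nat list set set" where
  "BP n = {P. partitioned_order n P}"

definition int_partitions :: "nat \<Rightarrow> nat multiset set" where
  "int_partitions n = {M. (\<forall>k\<in>#M. k > 0) \<and> sum_mset M = n}"

definition num_partitions :: "nat \<Rightarrow> nat" where
  "num_partitions n = card (int_partitions n)"

definition partition_enumeration :: "nat \<Rightarrow> (nat \<Rightarrow> nat multiset) \<Rightarrow> bool" where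
  "partition_enumeration n part \<longleftrightarrow> bij_betw part {1..num_partitions n} (int_partitions n)"

definition max_part :: "nat multiset \<Rightarrow> nat" where
  "max_part M = Max (set_mset M)"

lemma finite_int_partitions: "finite (int_partitions n)"
proof -
  have size_le: "size M \<le> sum_mset M" if "\<forall>k\<in>#M. k > 0" for M :: "nat multiset"
    using that by (induction M) auto
  have "int_partitions n \<subseteq> mset ` {xs. set xs \<subseteq> {0..n} \<and> length xs \<le> n}"
  proof
    fix M assume M: "M \<in> int_partitions n"
    obtain xs where xs: "M = mset xs" by (metis ex_mset)
    have "k \<le> n" if "k \<in># M" for k
      using M that by (auto simp: int_partitions_def dest!: multi_member_split)
    moreover have "size M \<le> n"
      using M size_le[of M] by (auto simp: int_partitions_def)
    ultimately show "M \<in> mset ` {xs. set xs \<subseteq> {0..n} \<and> length xs \<le> n}"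
      using xs by auto
  qed
  then show ?thesis
    by (rule finite_subset) (intro finite_imageI finite_lists_length_le finite_atLeastAtMost)
qed

text \<open>Hypotheses of the form \<open>partition_enumeration n part\<close> are satisfiable.\<close>

lemma ex_partition_enumeration: "\<exists>part. partition_enumeration n part"
  unfolding partition_enumeration_def num_partitions_def
  by (rule ex_bij_betw_nat_finite_1[OF finite_int_partitions])

end

theory Submission
  imports Defs
begin

text \<open>Sort the partitioned orders by shape, the multiset of lengths of their sequences; the
  shapes that occur are integer partitions of n (\<open>BP_eq_UN_orders_of_shape\<close>). If m_j
  sequences have length j, the orders of that shape number n! / (product of the m_j!): writing the
  sequences one after another by length gives a permutation, and only the arrangement of sequences
  of equal length is arbitrary. \<open>card_orders_of_shape\<close> proves this count by induction
  on the shape, detaching one sequence at a time; the ground set is therefore an arbitrary finite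
  \<open>A\<close>. The product in the formula has the same value: binomials and factorials
  telescope (\<open>prod_binomial_telescope\<close>), and nothing remains once the parts have used
  up n.\<close>

definition orders_of_shape :: "'a set \<Rightarrow> nat multiset \<Rightarrow> 'a list set set" where
  "orders_of_shape A M =
     {P. finite P \<and> (\<forall>S\<in>P. S \<noteq> [] \<and> distinct S) \<and> disjoint_family_on set P \<and>
         (\<Union>S\<in>P. set S) = A \<and> image_mset length (mset_set P) = M}"

lemma finite_orders_of_shape:
  assumes "finite A"
  shows "finite (orders_of_shape A M)"
proof (rule finite_subset)
  show "orders_of_shape A M \<subseteq> Pow {xs. set xs \<subseteq> A \<and> distinct xs}"
    by (auto simp: orders_of_shape_def)
  show "finite (Pow {xs. set xs \<subseteq> A \<and> distinct xs})"
    using finite_subset_distinct[OF assms] by simp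
qed

lemma orders_of_shape_empty: "orders_of_shape {} {#} = {{}}"
  by (auto simp: orders_of_shape_def mset_set_empty_iff disjoint_family_on_def)

lemma orders_of_shape_remove:
  assumes "P \<in> orders_of_shape A (add_mset (length S) M)" "S \<in> P"
  shows "P - {S} \<in> orders_of_shape (A - set S) M"
proof -
  have P: "finite P" "\<forall>S\<in>P. S \<noteq> [] \<and> distinct S" "disjoint_family_on set P"
    "(\<Union>S\<in>P. set S) = A" "image_mset length (mset_set P) = add_mset (length S) M"
    using assms(1) by (auto simp: orders_of_shape_def)
  have "mset_set P = add_mset S (mset_set (P - {S}))"
    using P(1) assms(2) by (rule mset_set.remove)
  with P(5) have "image_mset length (mset_set (P - {S})) = M"
    by simp
  moreover have "set T \<inter> set S = {}" if "T \<in> P - {S}" for T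
    using P(3) assms(2) that by (auto simp: disjoint_family_on_def)
  then have "(\<Union>T\<in>P - {S}. set T) = A - set S"
    using P(4) by blast
  ultimately show ?thesis
    using P by (auto simp: orders_of_shape_def disjoint_family_on_def)
qed

text \<open>The sequences of \<open>P\<close> avoid \<open>set S\<close>, and \<open>S\<close> is
  nonempty, so \<open>S\<close> is new to \<open>P\<close> and insertion adds exactly one part to
  the shape. This inverts the deletion in \<open>orders_of_shape_remove\<close>.\<close>

lemma orders_of_shape_insert:
  assumes "P \<in> orders_of_shape (A - set S) M" "S \<noteq> []" "distinct S" "set S \<subseteq> A"
  shows "S \<notin> P" "insert S P \<in> orders_of_shape A (add_mset (length S) M)"
proof -
  have P: "finite P" "\<forall>S\<in>P. S \<noteq> [] \<and> distinct S" "disjoint_family_on set P"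
    "(\<Union>S\<in>P. set S) = A - set S" "image_mset length (mset_set P) = M"
    using assms(1) by (auto simp: orders_of_shape_def)
  show S: "S \<notin> P"
  proof
    assume "S \<in> P"
    then have "set S \<subseteq> A - set S"
      using P(4) by blast
    with assms(2) show False
      by (cases S) auto
  qed
  have "disjoint_family_on set (insert S P)"
    using P(3,4) by (auto simp: disjoint_family_on_def)
  moreover have "(\<Union>T\<in>insert S P. set T) = A"
    using P(4) assms(4) by auto
  ultimately show "insert S P \<in> orders_of_shape A (add_mset (length S) M)"
    using P(1,2,5) S assms(2,3) by (simp add: orders_of_shape_def)
qed

text \<open>Each member of \<open>P\<close> has multiplicity one in \<open>mset_set P\<close>, so a
  multiplicity in the shape is a number of sequences. It gives the number of choices for a
  distinguished sequence.\<close>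

lemma card_length_eq_orders_of_shape:
  assumes "P \<in> orders_of_shape A M"
  shows "card {S \<in> P. length S = k} = count M k"
proof -
  have P: "finite P" "image_mset length (mset_set P) = M"
    using assms by (auto simp: orders_of_shape_def)
  have "count M k = sum (count (mset_set P)) (length -` {k} \<inter> set_mset (mset_set P))"
    by (simp flip: P(2) add: count_image_mset)
  also have "\<dots> = sum (count (mset_set P)) {S \<in> P. length S = k}"
    using P(1) by (intro sum.cong) auto
  also have "\<dots> = card {S \<in> P. length S = k}"
    using P(1) by simp
  finally show ?thesis ..
qed

text \<open>Count the pairs of an order \<open>P\<close> and a distinguished sequence of length \<open>k\<close> in \<open>P\<close>: choose
  the sequence inside \<open>P\<close>, or choose the sequence first and then the remainder of \<open>P\<close>.\<close>

lemma card_orders_of_shape_add_mset: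
  assumes "finite A" "k > 0" "k \<le> card A"
    and rest: "\<And>B. B \<subseteq> A \<Longrightarrow> card B = card A - k \<Longrightarrow> card (orders_of_shape B M) = c"
  shows "Suc (count M k) * card (orders_of_shape A (add_mset k M)) * fact (card A - k) =
    fact (card A) * c"
proof -
  \<comment> \<open>\<open>L\<close> holds the candidates for the distinguished sequence;
    \<open>X\<close> chooses the order first, \<open>Y\<close> the sequence first.\<close>
  define L where "L = {xs. length xs = k \<and> distinct xs \<and> set xs \<subseteq> A}"
  define X where "X = Sigma (orders_of_shape A (add_mset k M)) (\<lambda>P. {S \<in> P. length S = k})"
  define Y where "Y = Sigma L (\<lambda>S. orders_of_shape (A - set S) M)"
  have finL: "finite L"
    unfolding L_def by (rule finite_subset[OF _ finite_subset_distinct[OF assms(1)]]) auto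
  have "bij_betw (\<lambda>(P, S). (S, P - {S})) X Y"
  proof (rule bij_betw_byWitness[where f' = "\<lambda>(S, P). (insert S P, S)"])
    show "\<forall>x\<in>X. (case case x of (P, S) \<Rightarrow> (S, P - {S}) of (S, P) \<Rightarrow> (insert S P, S)) = x"
      by (auto simp: X_def)
    show "\<forall>y\<in>Y. (case case y of (S, P) \<Rightarrow> (insert S P, S) of (P, S) \<Rightarrow> (S, P - {S})) = y"
    proof
      fix y assume "y \<in> Y"
      moreover obtain S P where y: "y = (S, P)"
        by (cases y)
      ultimately have "S \<notin> P"
        using assms(2) orders_of_shape_insert(1)[of P A S M] by (auto simp: Y_def L_def)
      then show "(case case y of (S, P) \<Rightarrow> (insert S P, S) of (P, S) \<Rightarrow> (S, P - {S})) = y"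
        by (simp add: y)
    qed
    show "(\<lambda>(P, S). (S, P - {S})) ` X \<subseteq> Y"
    proof clarify
      fix P S assume "(P, S) \<in> X"
      then have PS: "P \<in> orders_of_shape A (add_mset (length S) M)" "S \<in> P" "length S = k"
        by (auto simp: X_def)
      then have "distinct S" "set S \<subseteq> A"
        by (auto simp: orders_of_shape_def)
      with PS show "(S, P - {S}) \<in> Y"
        using orders_of_shape_remove[OF PS(1,2)] by (simp add: Y_def L_def)
    qed
    show "(\<lambda>(S, P). (insert S P, S)) ` Y \<subseteq> X"
    proof clarify
      fix S P assume "(S, P) \<in> Y"
      then show "(insert S P, S) \<in> X"
        using assms(2) orders_of_shape_insert(2)[of P A S M] by (auto simp: X_def Y_def L_def)
    qed
  qed
  then have "card X = card Y"
    by (rule bij_betw_same_card)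
  moreover have "card X = card (orders_of_shape A (add_mset k M)) * Suc (count M k)"
  proof -
    have "card X = (\<Sum>P\<in>orders_of_shape A (add_mset k M). card {S \<in> P. length S = k})"
      unfolding X_def using finite_orders_of_shape[OF assms(1)]
      by (intro card_SigmaI) (auto simp: orders_of_shape_def)
    then show ?thesis
      by (simp add: card_length_eq_orders_of_shape)
  qed
  moreover have "card Y = card L * c"
  proof -
    have "card Y = (\<Sum>S\<in>L. card (orders_of_shape (A - set S) M))"
      unfolding Y_def using finL finite_orders_of_shape assms(1)
      by (intro card_SigmaI) auto
    also have "\<dots> = (\<Sum>S\<in>L. c)"
    proof (rule sum.cong[OF refl])
      fix S assume "S \<in> L"
      then have "card (A - set S) = card A - k"
        by (auto simp: L_def card_Diff_subset distinct_card)
      then show "card (orders_of_shape (A - set S) M) = c"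
        by (intro rest) auto
    qed
    finally show ?thesis by simp
  qed
  \<comment> \<open>\<open>card L\<close> is a falling factorial; multiplying by
    \<open>fact (card A - k)\<close> avoids a division.\<close>
  moreover have "card L * fact (card A - k) = fact (card A)"
  proof -
    have "card L = \<Prod>{card A - k + 1..card A}"
      unfolding L_def using assms(1,3) by (rule card_lists_distinct_length_eq)
    also have "\<dots> = fact (card A) div fact (card A - k)"
      by (simp add: fact_div_fact)
    finally show ?thesis
      by (simp add: fact_dvd)
  qed
  ultimately show ?thesis
    by (metis (no_types, lifting) mult.assoc mult.commute)
qed

text \<open>Adding a part \<open>k\<close> multiplies the product of factorials by the new
  multiplicity of \<open>k\<close>, the very factor by which the double count overcounts. The index
  set \<open>J\<close> may exceed the support of \<open>M\<close>, since \<open>fact 0 = 1\<close>;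
  it stays fixed during the induction.\<close>

lemma card_orders_of_shape:
  assumes "finite A" "finite J" "set_mset M \<subseteq> J" "\<forall>k\<in>#M. k > 0" "sum_mset M = card A"
  shows "card (orders_of_shape A M) * (\<Prod>j\<in>J. fact (count M j)) = fact (card A)"
  using assms(1,3-5)
proof (induction M arbitrary: A)
  case empty
  then show ?case by (simp add: orders_of_shape_empty)
next
  case (add k M)
  \<comment> \<open>By the induction hypothesis the count depends only on the size of the ground
    set; \<open>c\<close> is that common value.\<close>
  define c :: nat where "c = fact (card A - k) div (\<Prod>j\<in>J. fact (count M j))"
  have k: "k > 0" "k \<le> card A" "k \<in> J" "card A - k = sum_mset M"
    using add.prems by auto
  have IH: "card (orders_of_shape B M) * (\<Prod>j\<in>J. fact (count M j)) = fact (card A - k)"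
    if "B \<subseteq> A" "card B = card A - k" for B
    using add.IH[of B] add.prems that k finite_subset[OF that(1)] by auto
  have rest: "card (orders_of_shape B M) = c" if "B \<subseteq> A" "card B = card A - k" for B
    unfolding c_def IH[OF that, symmetric] using assms(2) by simp
  \<comment> \<open>One actual subset of the right size shows that the division defining
    \<open>c\<close> is exact.\<close>
  obtain B where B: "B \<subseteq> A" "card B = card A - k"
    using obtain_subset_with_card_n[of "card A - k" A] by auto
  have c: "c * (\<Prod>j\<in>J. fact (count M j)) = fact (card A - k)"
    using IH[OF B] rest[OF B] by simp
  have "(\<Prod>j\<in>J. fact (count (add_mset k M) j)) =
      fact (Suc (count M k)) * (\<Prod>j\<in>J - {k}. fact (count M j) :: nat)"
    using assms(2) k(3) by (subst prod.remove[of _ k]) (auto intro!: prod.cong)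
  also have "\<dots> = Suc (count M k) * (\<Prod>j\<in>J. fact (count M j))"
    unfolding prod.remove[OF assms(2) k(3)] by (simp only: fact_Suc of_nat_id mult.assoc)
  finally have "card (orders_of_shape A (add_mset k M)) *
      (\<Prod>j\<in>J. fact (count (add_mset k M) j)) * fact (card A - k) =
      (Suc (count M k) * card (orders_of_shape A (add_mset k M)) * fact (card A - k)) *
      (\<Prod>j\<in>J. fact (count M j))"
    by (simp only: mult_ac)
  also have "\<dots> = fact (card A) * c * (\<Prod>j\<in>J. fact (count M j))"
    by (simp only: card_orders_of_shape_add_mset[OF add.prems(1) k(1,2) rest])
  also have "\<dots> = fact (card A) * fact (card A - k)"
    by (simp flip: c)
  finally show ?case by simp
qed

lemma sum_mset_eq_sum_count:
  fixes M :: "nat multiset"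
  assumes "finite J" "set_mset M \<subseteq> J"
  shows "sum_mset M = (\<Sum>k\<in>J. k * count M k)"
  using assms(2)
proof (induction M)
  case (add x M)
  have "(\<Sum>k\<in>J. k * count (add_mset x M) k) = (\<Sum>k\<in>J. k * count M k + (if k = x then k else 0))"
    by (rule sum.cong) auto
  then show ?case
    using add assms(1) by (simp add: sum.distrib)
qed simp

text \<open>If N is what remains of n before step j, the j-th factor is N! / ((N - a j)! (b j)!),
  and N - a j is what remains for the next step. The bound on the sum keeps the natural subtractions
  from truncating.\<close>

lemma prod_binomial_telescope:
  fixes a b :: "nat \<Rightarrow> nat"
  assumes "(\<Sum>k = 1..d. a k) \<le> n"
  shows "(\<Prod>j = 1..d. real ((n - (\<Sum>k = 1..j - 1. a k)) choose a j) * (fact (a j) / fact (b j))) *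
    fact (n - (\<Sum>k = 1..d. a k)) * (\<Prod>j = 1..d. fact (b j)) = fact n"
  using assms
proof (induction d)
  case (Suc d)
  define N where "N = n - (\<Sum>k = 1..d. a k)"
  have N: "a (Suc d) \<le> N" "n - (\<Sum>k = 1..Suc d. a k) = N - a (Suc d)"
    using Suc.prems by (auto simp: N_def)
  have "real (N choose a (Suc d)) * (fact (a (Suc d)) * fact (N - a (Suc d))) = fact N"
    using binomial_fact[OF N(1), where 'a = real] by simp
  moreover have "(\<Prod>j = 1..d. real ((n - (\<Sum>k = 1..j - 1. a k)) choose a j) * (fact (a j) / fact (b j))) *
      fact N * (\<Prod>j = 1..d. fact (b j)) = fact n" (is "?p * _ * ?q = _")
    using Suc by (simp add: N_def)
  ultimately have "?p * (real (N choose a (Suc d)) * fact (a (Suc d)) * fact (N - a (Suc d))) * ?q = fact n"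
    by (simp only: mult.assoc)
  then show ?case
    unfolding N(2) by (simp add: N_def mult_ac)
qed simp

lemma BP_eq_UN_orders_of_shape: "BP n = (\<Union>M\<in>int_partitions n. orders_of_shape {0..<n} M)"
proof (intro equalityI subsetI)
  fix P assume "P \<in> BP n"
  then have P: "finite P" "\<forall>S\<in>P. S \<noteq> [] \<and> distinct S" "disjoint_family_on set P"
    "(\<Union>S\<in>P. set S) = {0..<n}"
    by (auto simp: BP_def partitioned_order_def)
  have "n = card (\<Union>S\<in>P. set S)"
    using P(4) by simp
  \<comment> \<open>Disjointness of the entries makes the lengths add up to
    \<open>n\<close>.\<close>
  also have "\<dots> = (\<Sum>S\<in>P. card (set S))"
    using P(1,3) by (intro card_UN_disjoint) (auto simp: disjoint_family_on_def)
  also have "\<dots> = sum length P"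
    using P(2) by (intro sum.cong) (auto simp: distinct_card)
  finally have "image_mset length (mset_set P) \<in> int_partitions n"
    using P(1,2) by (auto simp: int_partitions_def sum_unfold_sum_mset)
  then show "P \<in> (\<Union>M\<in>int_partitions n. orders_of_shape {0..<n} M)"
    using P by (auto simp: orders_of_shape_def)
qed (auto simp: BP_def partitioned_order_def orders_of_shape_def)

theorem proposition2:
  fixes n :: nat and part :: "nat \<Rightarrow> nat multiset"
    and d :: "nat \<Rightarrow> nat" and m :: "nat \<Rightarrow> nat \<Rightarrow> nat"
  assumes "n \<ge> 1"
    and "partition_enumeration n part"
    and "\<And>i. i \<in> {1..num_partitions n} \<Longrightarrow> d i = max_part (part i)"
    and "\<And>i j. i \<in> {1..num_partitions n} \<Longrightarrow> m i j = count (part i) j"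
  shows "real (card (BP n)) =
    (\<Sum>i = 1..num_partitions n. \<Prod>j = 1..d i.
       real ((n - (\<Sum>k = 1..j - 1. k * m i k)) choose (j * m i j)) *
       (fact (j * m i j) / fact (m i j)))"
proof -
  have part: "bij_betw part {1..num_partitions n} (int_partitions n)"
    using assms(2) by (simp add: partition_enumeration_def)
  have "card (BP n) = (\<Sum>M\<in>int_partitions n. card (orders_of_shape {0..<n} M))"
    \<comment> \<open>The union is disjoint because an order determines its shape.\<close>
    unfolding BP_eq_UN_orders_of_shape
    using finite_int_partitions finite_orders_of_shape
    by (intro card_UN_disjoint) (auto simp: orders_of_shape_def)
  also have "\<dots> = (\<Sum>i = 1..num_partitions n. card (orders_of_shape {0..<n} (part i)))"
    by (rule sum.reindex_bij_betw[OF part, symmetric])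
  finally have "real (card (BP n)) =
      (\<Sum>i = 1..num_partitions n. real (card (orders_of_shape {0..<n} (part i))))"
    by simp
  also have "\<dots> = (\<Sum>i = 1..num_partitions n. \<Prod>j = 1..d i.
       real ((n - (\<Sum>k = 1..j - 1. k * m i k)) choose (j * m i j)) *
       (fact (j * m i j) / fact (m i j)))"
  proof (rule sum.cong[OF refl])
    fix i assume i: "i \<in> {1..num_partitions n}"
    have M: "\<forall>k\<in>#part i. k > 0" "sum_mset (part i) = n"
      using bij_betwE[OF part] i by (auto simp: int_partitions_def)
    have sub: "set_mset (part i) \<subseteq> {1..d i}"
      using M(1) assms(3)[OF i] by (auto simp: max_part_def Suc_le_eq)
    \<comment> \<open>The parts exhaust \<open>n\<close>, so the leftover factorial in the
      telescoped product is \<open>fact 0\<close>.\<close>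
    have sum: "(\<Sum>k = 1..d i. k * m i k) = n"
      using sum_mset_eq_sum_count[OF _ sub] M(2) assms(4)[OF i] by simp
    have "card (orders_of_shape {0..<n} (part i)) * (\<Prod>j = 1..d i. fact (m i j)) = (fact n :: nat)"
      using card_orders_of_shape[OF _ _ sub M(1), of "{0..<n}"] M(2) assms(4)[OF i] by simp
    then have "real (card (orders_of_shape {0..<n} (part i)) * (\<Prod>j = 1..d i. fact (m i j))) = fact n"
      by (simp only: of_nat_fact)
    moreover have nonzero: "(\<Prod>j = 1..d i. fact (m i j)) \<noteq> (0 :: real)"
      by simp
    \<comment> \<open>Multiplied by the product of the \<open>fact (m i j)\<close>, both sides equal
      \<open>fact n\<close>.\<close>
    ultimately show "real (card (orders_of_shape {0..<n} (part i))) = (\<Prod>j = 1..d i.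
       real ((n - (\<Sum>k = 1..j - 1. k * m i k)) choose (j * m i j)) *
       (fact (j * m i j) / fact (m i j)))"
      using prod_binomial_telescope[of "\<lambda>k. k * m i k" "d i" n "m i"] sum
      by (subst mult_right_cancel[OF nonzero, symmetric]) simp
  qed
  finally show ?thesis .
qed

end
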